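(* Let $n\ge2$, let $z\in\mathbb{R}^n$ and let $G=\mathbb{R}^n\setminus\{z\}$. Then $$\sup_{\substack{x,y\in G\\ x\ne y}}\frac{q(x,y)}{k_G(x,y)}=\frac{|z|+\sqrt{1+|z|^2}}{2}.$$
   Context: The chordal metric on $\mathbb{R}^n$ is $q(x,y)=\frac{|x-y|}{\sqrt{(1+|x|^2)(1+|y|^2)}}$ for $x,y\in\mathbb{R}^n$. For a domain $D\subsetneq\mathbb{R}^n$ the quasihyperbolic metric is $$k_D(x,y)=\inf_{\gamma\in\Gamma}\int_\gamma\frac{1}{d(w)}\,|dw|,\quad x,y\in D,$$ where $\Gamma$ is the family of all rectifiable curves in $D$ joining $x$ and $y$, and $d(w)=d(w,\partial D)$ is the Euclidean distance from $w$ to $\partial D$; for $D=G=\mathbb{R}^n\setminus\{z\}$ one has $d(w)=|w-z|$. *)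

theory Defs
  imports "HOL-Analysis.Analysis"
begin

definition chordal_metric :: "'a::euclidean_space \<Rightarrow> 'a \<Rightarrow> real" where
  "chordal_metric x y =
     norm (x - y) / sqrt ((1 + (norm x)\<^sup>2) * (1 + (norm y)\<^sup>2))"

text \<open>Lengths of the polygons inscribed in \<open>\<gamma>\<close> over the partitions
  \<open>a = t 0 \<le> t 1 \<le> \<dots> \<le> t n = b\<close>.\<close>

definition inscribed_lengths :: "(real \<Rightarrow> 'a::euclidean_space) \<Rightarrow> real \<Rightarrow> real \<Rightarrow> real set" where
  "inscribed_lengths \<gamma> a b =
     {\<Sum>i<n. dist (\<gamma> (t i)) (\<gamma> (t (Suc i))) | (n::nat) (t :: nat \<Rightarrow> real).
        t 0 = a \<and> t n = b \<and> (\<forall>i<n. t i \<le> t (Suc i))}"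

definition rectifiable_path :: "(real \<Rightarrow> 'a::euclidean_space) \<Rightarrow> bool" where
  "rectifiable_path \<gamma> \<longleftrightarrow> path \<gamma> \<and> bdd_above (inscribed_lengths \<gamma> 0 1)"

text \<open>The length of \<open>\<gamma>\<close> restricted to \<open>{a..b}\<close>; being a real supremum, it is meaningful
  only for rectifiable \<open>\<gamma>\<close> and \<open>0 \<le> a \<le> b \<le> 1\<close>.\<close>

definition curve_length :: "(real \<Rightarrow> 'a::euclidean_space) \<Rightarrow> real \<Rightarrow> real \<Rightarrow> real" where
  "curve_length \<gamma> a b = Sup (inscribed_lengths \<gamma> a b)"

text \<open>The parametrization of \<open>\<gamma>\<close> by arc length, on \<open>{0..curve_length \<gamma> 0 1}\<close>. The length
  function of a rectifiable path is continuous and nondecreasing, so a parameter \<open>t\<close> exists for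
  every such \<open>s\<close>, and the choice is immaterial because \<open>\<gamma>\<close> is constant wherever its
  length function is.\<close>

definition arc_length_param :: "(real \<Rightarrow> 'a::euclidean_space) \<Rightarrow> real \<Rightarrow> 'a" where
  "arc_length_param \<gamma> s = \<gamma> (SOME t. t \<in> {0..1} \<and> curve_length \<gamma> 0 t = s)"

text \<open>The line integral of \<open>\<rho>\<close> along \<open>\<gamma>\<close> with respect to arc length \<open>|dw|\<close>.\<close>

definition arc_length_integral ::
    "(real \<Rightarrow> 'a::euclidean_space) \<Rightarrow> ('a \<Rightarrow> real) \<Rightarrow> real" where
  "arc_length_integral \<gamma> \<rho> =
     integral {0..curve_length \<gamma> 0 1} (\<lambda>s. \<rho> (arc_length_param \<gamma> s))"

definition quasihyperbolic_metric :: "'a::euclidean_space set \<Rightarrow> 'a \<Rightarrow> 'a \<Rightarrow> real" where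
  "quasihyperbolic_metric D x y =
     Inf {arc_length_integral \<gamma> (\<lambda>w. 1 / infdist w (frontier D)) | \<gamma>.
            rectifiable_path \<gamma> \<and> path_image \<gamma> \<subseteq> D \<and> pathstart \<gamma> = x \<and> pathfinish \<gamma> = y}"

end

theory Submission
  imports Defs
begin

text \<open>Chordal length has density \<open>1 / (1 + \<parallel>w\<parallel>\<^sup>2)\<close> with respect to arc length and quasihyperbolic
  length has density \<open>1 / \<parallel>w - z\<parallel>\<close>. The supremum of the quotient of the two densities,
  \<open>\<parallel>w - z\<parallel> / (1 + \<parallel>w\<parallel>\<^sup>2)\<close>, is the constant in the theorem, and it is attained at a point \<open>x\<close> with
  \<open>\<parallel>x\<parallel> = \<surd>(1 + \<parallel>z\<parallel>\<^sup>2) - \<parallel>z\<parallel>\<close> in the direction opposite to \<open>z\<close>. Since the chordal metric is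
  pulled back from a Euclidean distance, comparing densities along the arc length parametrization of
  a curve gives the upper bound. The quotient of the metrics approaches the constant as \<open>y\<close> tends to
  this \<open>x\<close> along the ray.\<close>

section \<open>Length of curves\<close>

text \<open>Bounding each chord by an increment of \<open>W\<close> makes the polygon sum telescope.
  Every such \<open>W\<close> thus bounds length from above; \<open>W\<close> is later linear or a
  modified length function.\<close>

lemma inscribed_lengths_le:
  assumes "l \<in> inscribed_lengths \<gamma> a b"
    and W: "\<And>u v. a \<le> u \<Longrightarrow> u \<le> v \<Longrightarrow> v \<le> b \<Longrightarrow> dist (\<gamma> u) (\<gamma> v) \<le> W v - W u"
  shows "l \<le> W b - W a"
proof -
  obtain n t where l: "l = (\<Sum>i<n. dist (\<gamma> (t i)) (\<gamma> (t (Suc i))))"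
    and t: "t 0 = a" "t n = b" "\<And>i. i < n \<Longrightarrow> t i \<le> t (Suc i)"
    using assms(1) unfolding inscribed_lengths_def by blast
  have mono: "t i \<le> t j" if "i \<le> j" "j \<le> n" for i j
    using that by (induction j rule: dec_induct) (auto intro: order_trans[OF _ t(3)])
  have "l \<le> (\<Sum>i<n. W (t (Suc i)) - W (t i))"
    unfolding l
  proof (rule sum_mono)
    fix i assume i: "i \<in> {..<n}"
    then have "a \<le> t i" "t (Suc i) \<le> b"
      using mono[of 0 i] mono[of "Suc i" n] t by auto
    with i t(3) show "dist (\<gamma> (t i)) (\<gamma> (t (Suc i))) \<le> W (t (Suc i)) - W (t i)"
      by (intro W) auto
  qed
  also have "\<dots> = W b - W a"
    using sum_lessThan_telescope[of "\<lambda>i. W (t i)" n] t by simp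
  finally show ?thesis .
qed

lemma dist_in_inscribed_lengths:
  assumes "a \<le> b"
  shows "dist (\<gamma> a) (\<gamma> b) \<in> inscribed_lengths \<gamma> a b"
  unfolding inscribed_lengths_def mem_Collect_eq
  by (rule exI[of _ 1], rule exI[of _ "\<lambda>i. if i = 0 then a else b"]) (use assms in auto)

lemma inscribed_lengths_add:
  assumes "l \<in> inscribed_lengths \<gamma> a b" and "m \<in> inscribed_lengths \<gamma> b c"
  shows "l + m \<in> inscribed_lengths \<gamma> a c"
proof -
  obtain n t where l: "l = (\<Sum>i<n. dist (\<gamma> (t i)) (\<gamma> (t (Suc i))))"
    and t: "t 0 = a" "t n = b" "\<And>i. i < n \<Longrightarrow> t i \<le> t (Suc i)"
    using assms(1) unfolding inscribed_lengths_def by blast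
  obtain k s where m: "m = (\<Sum>i<k. dist (\<gamma> (s i)) (\<gamma> (s (Suc i))))"
    and s: "s 0 = b" "s k = c" "\<And>i. i < k \<Longrightarrow> s i \<le> s (Suc i)"
    using assms(2) unfolding inscribed_lengths_def by blast
  \<comment> \<open>The two partitions are glued at index \<open>n\<close>, where \<open>t n\<close>
    and \<open>s 0\<close> are both \<open>b\<close>.\<close>
  define r where "r i = (if i \<le> n then t i else s (i - n))" for i
  have r1: "r i = t i" if "i \<le> n" for i using that by (simp add: r_def)
  have r2: "r (n + i) = s i" for i using t(2) s(1) by (simp add: r_def)
  have "(\<Sum>i<n + k. dist (\<gamma> (r i)) (\<gamma> (r (Suc i)))) =
      (\<Sum>i<n. dist (\<gamma> (r i)) (\<gamma> (r (Suc i)))) +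
      (\<Sum>i<k. dist (\<gamma> (r (n + i))) (\<gamma> (r (n + Suc i))))"
    by (induction k) auto
  also have "\<dots> = l + m"
    unfolding l m r2 by (simp add: r1)
  finally have "l + m = (\<Sum>i<n + k. dist (\<gamma> (r i)) (\<gamma> (r (Suc i))))" by simp
  moreover have "r i \<le> r (Suc i)" if "i < n + k" for i
  proof (cases "i < n")
    case True
    then show ?thesis using t(3) by (simp add: r1)
  next
    case False
    then obtain j where "i = n + j" by (metis le_Suc_ex not_less)
    then show ?thesis using r2[of j] r2[of "Suc j"] s(3) that by simp
  qed
  ultimately show ?thesis
    unfolding inscribed_lengths_def using r1[of 0] r2[of k] t(1) s(2) by auto
qed

lemma curve_length_le:
  assumes "a \<le> b"
    and "\<And>u v. a \<le> u \<Longrightarrow> u \<le> v \<Longrightarrow> v \<le> b \<Longrightarrow> dist (\<gamma> u) (\<gamma> v) \<le> W v - W u"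
  shows "curve_length \<gamma> a b \<le> W b - W a"
  unfolding curve_length_def
proof (rule cSup_least)
  show "inscribed_lengths \<gamma> a b \<noteq> {}" using dist_in_inscribed_lengths[OF assms(1)] by blast
  show "l \<le> W b - W a" if "l \<in> inscribed_lengths \<gamma> a b" for l
    using inscribed_lengths_le[OF that] assms(2) by blast
qed

lemma curve_length_refl [simp]: "curve_length \<gamma> a a = 0"
proof -
  have "l = 0" if "l \<in> inscribed_lengths \<gamma> a a" for l
  proof -
    have "dist (\<gamma> u) (\<gamma> v) \<le> 0 - 0" if "a \<le> u" "u \<le> v" "v \<le> a" for u v
    proof -
      have "u = v" using that by linarith
      then show ?thesis by simp
    qed
    from inscribed_lengths_le[OF that, of "\<lambda>_. 0", OF this] have "l \<le> 0" by simp
    moreover have "0 \<le> l" using that unfolding inscribed_lengths_def by (auto intro: sum_nonneg)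
    ultimately show ?thesis by simp
  qed
  moreover have "0 \<in> inscribed_lengths \<gamma> a a" using dist_in_inscribed_lengths[of a a \<gamma>] by simp
  ultimately have "inscribed_lengths \<gamma> a a = {0}" by blast
  then show ?thesis by (simp add: curve_length_def)
qed

lemma bdd_above_inscribed_lengths:
  assumes "rectifiable_path \<gamma>" "0 \<le> a" "a \<le> b" "b \<le> 1"
  shows "bdd_above (inscribed_lengths \<gamma> a b)"
proof -
  obtain B where B: "\<And>l. l \<in> inscribed_lengths \<gamma> 0 1 \<Longrightarrow> l \<le> B"
    using assms(1) unfolding rectifiable_path_def bdd_above_def by blast
  have "l \<le> B" if "l \<in> inscribed_lengths \<gamma> a b" for l
  proof -
    have "dist (\<gamma> 0) (\<gamma> a) + l + dist (\<gamma> b) (\<gamma> 1) \<in> inscribed_lengths \<gamma> 0 1"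
      using assms that by (intro inscribed_lengths_add[of _ _ _ b] inscribed_lengths_add[of _ _ _ a]
        dist_in_inscribed_lengths)
    from B[OF this] show ?thesis using zero_le_dist[of "\<gamma> 0" "\<gamma> a"] zero_le_dist[of "\<gamma> b" "\<gamma> 1"] by linarith
  qed
  then show ?thesis by (rule bdd_aboveI)
qed

lemma dist_le_curve_length:
  assumes "rectifiable_path \<gamma>" "0 \<le> a" "a \<le> b" "b \<le> 1"
  shows "dist (\<gamma> a) (\<gamma> b) \<le> curve_length \<gamma> a b"
  unfolding curve_length_def
  by (intro cSup_upper dist_in_inscribed_lengths bdd_above_inscribed_lengths assms)

lemma curve_length_superadditive:
  assumes \<gamma>: "rectifiable_path \<gamma>" and le: "0 \<le> a" "a \<le> b" "b \<le> c" "c \<le> 1"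
  shows "curve_length \<gamma> a b + curve_length \<gamma> b c \<le> curve_length \<gamma> a c"
proof -
  have ne: "inscribed_lengths \<gamma> a b \<noteq> {}" "inscribed_lengths \<gamma> b c \<noteq> {}"
    using dist_in_inscribed_lengths le by blast+
  have 1: "l + m \<le> curve_length \<gamma> a c"
    if "l \<in> inscribed_lengths \<gamma> a b" "m \<in> inscribed_lengths \<gamma> b c" for l m
    unfolding curve_length_def using that le
    by (intro cSup_upper inscribed_lengths_add[of _ _ _ b] bdd_above_inscribed_lengths \<gamma>) auto
  \<comment> \<open>The suprema are taken one at a time, the other polygon being held fixed.\<close>
  have "curve_length \<gamma> a b \<le> curve_length \<gamma> a c - m" if m: "m \<in> inscribed_lengths \<gamma> b c" for m
    unfolding curve_length_def[of \<gamma> a b] by (rule cSup_least[OF ne(1)]) (use 1 m in force)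
  then have "m \<le> curve_length \<gamma> a c - curve_length \<gamma> a b" if "m \<in> inscribed_lengths \<gamma> b c" for m
    using that by force
  then have "curve_length \<gamma> b c \<le> curve_length \<gamma> a c - curve_length \<gamma> a b"
    unfolding curve_length_def[of \<gamma> b c] by (rule cSup_least[OF ne(2)])
  then show ?thesis by simp
qed

text \<open>This makes the length function itself a dominating function for chords; all later
  estimates of chords by length go through it.\<close>

lemma dist_le_curve_length_diff:
  assumes "rectifiable_path \<gamma>" "0 \<le> a" "a \<le> b" "b \<le> 1"
  shows "dist (\<gamma> a) (\<gamma> b) \<le> curve_length \<gamma> 0 b - curve_length \<gamma> 0 a"
  using dist_le_curve_length[OF assms] curve_length_superadditive[of \<gamma> 0 a b] assms by linarith

lemma curve_length_mono:
  assumes "rectifiable_path \<gamma>" "0 \<le> a" "a \<le> b" "b \<le> 1"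
  shows "curve_length \<gamma> 0 a \<le> curve_length \<gamma> 0 b"
  using dist_le_curve_length_diff[OF assms] zero_le_dist[of "\<gamma> a" "\<gamma> b"] by linarith

text \<open>If the length function jumped over \<open>s\<close> at \<open>c\<close>, then lowering it by the height of the jump
  after \<open>c\<close> would still dominate all chords, contradicting minimality of the length.\<close>

lemma curve_length_surj:
  assumes \<gamma>: "rectifiable_path \<gamma>" and s: "0 \<le> s" "s \<le> curve_length \<gamma> 0 1"
  shows "\<exists>t\<in>{0..1}. curve_length \<gamma> 0 t = s"
proof -
  define V where "V = curve_length \<gamma> 0"
  have dV: "dist (\<gamma> u) (\<gamma> v) \<le> V v - V u" if "0 \<le> u" "u \<le> v" "v \<le> 1" for u v
    unfolding V_def using dist_le_curve_length_diff[OF \<gamma> that] .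
  have mV: "V u \<le> V v" if "0 \<le> u" "u \<le> v" "v \<le> 1" for u v
    unfolding V_def using curve_length_mono[OF \<gamma> that] .
  have V0: "V 0 = 0" by (simp add: V_def)
  have cont: "continuous_on {0..1} \<gamma>" using \<gamma> by (simp add: rectifiable_path_def path_def)
  \<comment> \<open>The candidate parameter is the supremum \<open>c\<close> of those at which the
    length is at most \<open>s\<close>; both strict inequalities between \<open>V c\<close> and
    \<open>s\<close> are refuted.\<close>
  define T where "T = {t\<in>{0..1}. V t \<le> s}"
  define c where "c = Sup T"
  have T0: "0 \<in> T" using s V0 by (simp add: T_def)
  have bT: "bdd_above T" by (rule bdd_aboveI[of _ 1]) (simp add: T_def)
  have c0: "0 \<le> c" using cSup_upper[OF T0 bT] by (simp add: c_def)
  have c1: "c \<le> 1" unfolding c_def by (rule cSup_least) (use T0 in blast, simp add: T_def)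
  have below: "V u \<le> s" if u: "0 \<le> u" "u < c" for u
  proof -
    have "T \<noteq> {}" using T0 by blast
    then obtain t where "t \<in> T" "u < t"
      using less_cSupD[of T u] u(2) by (auto simp: c_def)
    then have "V u \<le> V t" "V t \<le> s" using mV[of u t] u(1) by (simp_all add: T_def)
    then show ?thesis by simp
  qed
  have above: "s < V u" if "c < u" "u \<le> 1" for u
  proof (rule ccontr)
    assume "\<not> s < V u"
    then have "u \<in> T" using that c0 by (simp add: T_def)
    then show False using cSup_upper[OF _ bT] that by (force simp: c_def)
  qed
  have "V c \<le> s"
  proof (rule ccontr)
    assume *: "\<not> V c \<le> s"
    then have cpos: "0 < c" using V0 s c0 by (cases "c = 0") auto
    \<comment> \<open>Chords ending before \<open>c\<close> obey this bound by \<open>below\<close>,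
      and continuity of the path carries it to the endpoint \<open>c\<close>.\<close>
    have left: "dist (\<gamma> u) (\<gamma> c) \<le> s - V u" if u: "0 \<le> u" "u < c" for u
    proof (rule tendsto_upperbound)
      have "(\<gamma> \<longlongrightarrow> \<gamma> c) (at c within {0..1})"
        using cont c0 c1 by (simp add: continuous_on_def)
      then have "(\<gamma> \<longlongrightarrow> \<gamma> c) (at c within {u..<c})"
        by (rule tendsto_within_subset) (use c1 u in auto)
      then show "((\<lambda>v. dist (\<gamma> u) (\<gamma> v)) \<longlongrightarrow> dist (\<gamma> u) (\<gamma> c)) (at c within {u..<c})"
        by (intro tendsto_intros)
      have "dist (\<gamma> u) (\<gamma> v) \<le> s - V u" if "u \<le> v" "v < c" for v
        using dV[of u v] below[of v] that u c1 by linarith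
      then show "\<forall>\<^sub>F v in at c within {u..<c}. dist (\<gamma> u) (\<gamma> v) \<le> s - V u"
        by (auto simp: eventually_at_filter)
      show "at c within {u..<c} \<noteq> bot"
        using u by (simp add: at_within_eq_bot_iff)
    qed
    \<comment> \<open>On the interval from 0 to \<open>c\<close> only the value at \<open>c\<close>
      is lowered, to \<open>s\<close>; \<open>cpos\<close> keeps the value at 0 unchanged.\<close>
    define W where "W u = (if u < c then V u else V u - (V c - s))" for u
    have "curve_length \<gamma> 0 c \<le> W c - W 0"
    proof (rule curve_length_le[OF c0])
      fix u v assume uv: "0 \<le> u" "u \<le> v" "v \<le> c"
      show "dist (\<gamma> u) (\<gamma> v) \<le> W v - W u"
        using dV[OF uv(1,2)] left[of u] uv c1 by (cases "v = c") (auto simp: W_def)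
    qed
    then show False using * cpos V0 by (simp add: W_def flip: V_def)
  qed
  moreover have "s \<le> V c"
  proof (rule ccontr)
    assume *: "\<not> s \<le> V c"
    then have clt: "c < 1" using s c1 V_def by (cases "c = 1") auto
    have right: "dist (\<gamma> c) (\<gamma> v) \<le> V v - s" if v: "c < v" "v \<le> 1" for v
    proof (rule tendsto_upperbound)
      have "(\<gamma> \<longlongrightarrow> \<gamma> c) (at c within {0..1})"
        using cont c0 c1 by (simp add: continuous_on_def)
      then have "(\<gamma> \<longlongrightarrow> \<gamma> c) (at c within {c<..v})"
        by (rule tendsto_within_subset) (use c0 v in auto)
      then show "((\<lambda>u. dist (\<gamma> u) (\<gamma> v)) \<longlongrightarrow> dist (\<gamma> c) (\<gamma> v)) (at c within {c<..v})"
        by (intro tendsto_intros)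
      have "dist (\<gamma> u) (\<gamma> v) \<le> V v - s" if "c < u" "u \<le> v" for u
        using dV[of u v] above[of u] that v c0 by linarith
      then show "\<forall>\<^sub>F u in at c within {c<..v}. dist (\<gamma> u) (\<gamma> v) \<le> V v - s"
        by (auto simp: eventually_at_filter)
      show "at c within {c<..v} \<noteq> bot"
        using v by (simp add: at_within_eq_bot_iff)
    qed
    \<comment> \<open>Here everything strictly after \<open>c\<close> is lowered; \<open>clt\<close>
      ensures that this includes the endpoint 1.\<close>
    define W where "W u = (if u \<le> c then V u else V u - (s - V c))" for u
    have "curve_length \<gamma> 0 1 \<le> W 1 - W 0"
    proof (rule curve_length_le)
      fix u v :: real assume uv: "0 \<le> u" "u \<le> v" "v \<le> 1"
      have "dist (\<gamma> u) (\<gamma> v) \<le> dist (\<gamma> u) (\<gamma> c) + dist (\<gamma> c) (\<gamma> v)" by (rule dist_triangle)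
      then show "dist (\<gamma> u) (\<gamma> v) \<le> W v - W u"
        using dV[OF uv] right[of v] dV[of u c] uv c1 by (auto simp: W_def)
    qed simp
    then show False using * clt V0 c0 by (simp add: W_def flip: V_def)
  qed
  ultimately show ?thesis using c0 c1 by (auto simp: V_def)
qed

section \<open>Parametrization by arc length\<close>

lemma arc_length_paramE:
  assumes "rectifiable_path \<gamma>" "s \<in> {0..curve_length \<gamma> 0 1}"
  obtains t where "t \<in> {0..1}" "curve_length \<gamma> 0 t = s" "arc_length_param \<gamma> s = \<gamma> t"
proof -
  define t where "t = (SOME t. t \<in> {0..1} \<and> curve_length \<gamma> 0 t = s)"
  have "t \<in> {0..1} \<and> curve_length \<gamma> 0 t = s"
    unfolding t_def by (rule someI_ex) (use curve_length_surj[OF assms(1), of s] assms(2) in auto)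
  then show ?thesis using that by (auto simp: arc_length_param_def t_def)
qed

lemma arc_length_param_in_path_image:
  assumes "rectifiable_path \<gamma>" "s \<in> {0..curve_length \<gamma> 0 1}"
  shows "arc_length_param \<gamma> s \<in> path_image \<gamma>"
  by (rule arc_length_paramE[OF assms]) (simp add: path_image_def)

lemma dist_arc_length_param_le:
  assumes \<gamma>: "rectifiable_path \<gamma>"
    and s: "s \<in> {0..curve_length \<gamma> 0 1}" and s': "s' \<in> {0..curve_length \<gamma> 0 1}"
  shows "dist (arc_length_param \<gamma> s) (arc_length_param \<gamma> s') \<le> \<bar>s - s'\<bar>"
proof -
  obtain t where t: "t \<in> {0..1}" "curve_length \<gamma> 0 t = s" "arc_length_param \<gamma> s = \<gamma> t"
    using arc_length_paramE[OF \<gamma> s] .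
  obtain t' where t': "t' \<in> {0..1}" "curve_length \<gamma> 0 t' = s'" "arc_length_param \<gamma> s' = \<gamma> t'"
    using arc_length_paramE[OF \<gamma> s'] .
  show ?thesis
    using dist_le_curve_length_diff[OF \<gamma>, of t t'] dist_le_curve_length_diff[OF \<gamma>, of t' t] t t'
    by (cases "t \<le> t'") (auto simp: dist_commute)
qed

lemma continuous_on_arc_length_param:
  assumes "rectifiable_path \<gamma>"
  shows "continuous_on {0..curve_length \<gamma> 0 1} (arc_length_param \<gamma>)"
  by (rule lipschitz_on_continuous_on[of 1], rule lipschitz_onI)
    (use dist_arc_length_param_le[OF assms] in \<open>simp_all add: dist_real_def\<close>)

text \<open>The parameter chosen for length 0 may differ from 0, but the chord back to the start has
  length at most 0.\<close>

lemma arc_length_param_0: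
  assumes \<gamma>: "rectifiable_path \<gamma>"
  shows "arc_length_param \<gamma> 0 = pathstart \<gamma>"
proof -
  have "0 \<in> {0..curve_length \<gamma> 0 1}" using curve_length_mono[OF \<gamma>, of 0 1] by simp
  then obtain t where t: "t \<in> {0..1}" "curve_length \<gamma> 0 t = 0" "arc_length_param \<gamma> 0 = \<gamma> t"
    using arc_length_paramE[OF \<gamma>] by blast
  then show ?thesis using dist_le_curve_length_diff[OF \<gamma>, of 0 t] by (simp add: pathstart_def)
qed

lemma arc_length_param_length:
  assumes \<gamma>: "rectifiable_path \<gamma>"
  shows "arc_length_param \<gamma> (curve_length \<gamma> 0 1) = pathfinish \<gamma>"
proof -
  have "curve_length \<gamma> 0 1 \<in> {0..curve_length \<gamma> 0 1}" using curve_length_mono[OF \<gamma>, of 0 1] by simp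
  then obtain t where t: "t \<in> {0..1}" "curve_length \<gamma> 0 t = curve_length \<gamma> 0 1"
      "arc_length_param \<gamma> (curve_length \<gamma> 0 1) = \<gamma> t"
    using arc_length_paramE[OF \<gamma>] by blast
  then show ?thesis using dist_le_curve_length_diff[OF \<gamma>, of t 1] by (simp add: pathfinish_def)
qed

lemma continuous_on_compose_arc_length_param:
  assumes "rectifiable_path \<gamma>" "continuous_on (path_image \<gamma>) \<rho>"
  shows "continuous_on {0..curve_length \<gamma> 0 1} (\<lambda>s. \<rho> (arc_length_param \<gamma> s))"
  by (rule continuous_on_compose2[OF assms(2) continuous_on_arc_length_param[OF assms(1)]])
    (use arc_length_param_in_path_image[OF assms(1)] in blast)

lemma arc_length_integral_le:
  assumes \<gamma>: "rectifiable_path \<gamma>" and "continuous_on (path_image \<gamma>) \<rho>"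
    and M: "\<And>w. w \<in> path_image \<gamma> \<Longrightarrow> \<rho> w \<le> M"
  shows "arc_length_integral \<gamma> \<rho> \<le> M * curve_length \<gamma> 0 1"
proof -
  have "arc_length_integral \<gamma> \<rho> \<le> integral {0..curve_length \<gamma> 0 1} (\<lambda>s. M)"
    unfolding arc_length_integral_def
  proof (rule integral_le)
    show "(\<lambda>s. \<rho> (arc_length_param \<gamma> s)) integrable_on {0..curve_length \<gamma> 0 1}"
      by (intro integrable_continuous_real continuous_on_compose_arc_length_param assms)
  qed (use M arc_length_param_in_path_image[OF \<gamma>] in auto)
  then show ?thesis using curve_length_mono[OF \<gamma>, of 0 1] by (simp add: mult.commute)
qed

section \<open>Lipschitz paths and rectifiable connectedness of open sets\<close>

lemma lipschitz_imp_rectifiable_path: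
  assumes "\<And>u v. 0 \<le> u \<Longrightarrow> u \<le> v \<Longrightarrow> v \<le> 1 \<Longrightarrow> dist (\<gamma> u) (\<gamma> v) \<le> K * (v - u)"
  shows "rectifiable_path \<gamma>" and "curve_length \<gamma> 0 1 \<le> K"
proof -
  have W: "dist (\<gamma> u) (\<gamma> v) \<le> K * v - K * u" if "0 \<le> u" "u \<le> v" "v \<le> 1" for u v
    using assms[OF that] by (simp add: algebra_simps)
  have "0 \<le> K" using assms[of 0 1] zero_le_dist[of "\<gamma> 0" "\<gamma> 1"] by (simp del: zero_le_dist)
  moreover have "dist (\<gamma> u) (\<gamma> v) \<le> K * dist u v" if "u \<in> {0..1}" "v \<in> {0..1}" for u v
    using assms[of u v] assms[of v u] that by (cases "u \<le> v") (auto simp: dist_real_def dist_commute)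
  ultimately have "K-lipschitz_on {0..1} \<gamma>" by (intro lipschitz_onI) auto
  then have "path \<gamma>" unfolding path_def by (rule lipschitz_on_continuous_on)
  moreover have "bdd_above (inscribed_lengths \<gamma> 0 1)"
    using inscribed_lengths_le[of _ \<gamma> 0 1 "\<lambda>u. K * u"] W by (intro bdd_aboveI[of _ K]) force
  ultimately show "rectifiable_path \<gamma>" by (simp add: rectifiable_path_def)
  show "curve_length \<gamma> 0 1 \<le> K"
    using curve_length_le[of 0 1 \<gamma> "\<lambda>u. K * u"] W by simp
qed

text \<open>A polynomial path has a derivative bounded on the compact parameter interval, hence is
  Lipschitz. The lemma provides admissible curves for the infimum defining the quasihyperbolic
  metric.\<close>

lemma connected_open_rectifiable:
  fixes S :: "'a::euclidean_space set"
  assumes "open S" "connected S" "x \<in> S" "y \<in> S"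
  obtains \<gamma> where "rectifiable_path \<gamma>" "path_image \<gamma> \<subseteq> S" "pathstart \<gamma> = x" "pathfinish \<gamma> = y"
proof -
  obtain \<gamma> where p: "polynomial_function \<gamma>"
    and \<gamma>: "path_image \<gamma> \<subseteq> S" "pathstart \<gamma> = x" "pathfinish \<gamma> = y"
    using connected_open_polynomial_connected[OF assms] by blast
  obtain \<gamma>' where p': "polynomial_function \<gamma>'"
    and d: "\<And>u. (\<gamma> has_vector_derivative \<gamma>' u) (at u)"
    using has_vector_derivative_polynomial_function[OF p] by blast
  have "compact (\<gamma>' ` {0..1})"
    using continuous_on_polymonial_function[OF p'] by (intro compact_continuous_image) auto
  then obtain K where "\<forall>w\<in>\<gamma>' ` {0..1}. norm w \<le> K"
    using compact_imp_bounded bounded_iff by metis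
  then have K: "norm (\<gamma>' u) \<le> K" if "u \<in> {0..1}" for u
    using that by blast
  have "dist (\<gamma> u) (\<gamma> v) \<le> K * (v - u)" if "0 \<le> u" "u \<le> v" "v \<le> 1" for u v
  proof -
    have "norm (\<gamma> u - \<gamma> v) \<le> K * norm (u - v)"
    proof (rule differentiable_bound[of "{0..1}" _ "\<lambda>u h. h *\<^sub>R \<gamma>' u"])
      fix w :: real assume w: "w \<in> {0..1}"
      show "(\<gamma> has_derivative (\<lambda>h. h *\<^sub>R \<gamma>' w)) (at w within {0..1})"
        using d[of w] unfolding has_vector_derivative_def by (rule has_derivative_at_withinI)
      have "norm (h *\<^sub>R \<gamma>' w) \<le> K * norm h" for h
        using mult_right_mono[OF K[OF w], of "\<bar>h\<bar>"] by (simp add: mult.commute)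
      then show "onorm (\<lambda>h. h *\<^sub>R \<gamma>' w) \<le> K" by (rule onorm_le)
    qed (use that in auto)
    then show ?thesis using that by (simp add: dist_norm)
  qed
  then show ?thesis using lipschitz_imp_rectifiable_path that \<gamma> by blast
qed

section \<open>The chordal metric along a curve\<close>

text \<open>Up to an error proportional to the length of the interval, the estimate holds near each
  point by continuity of \<open>\<phi>\<close> and is additive over adjacent intervals, so bisection
  makes it global.\<close>

lemma dist_le_integral:
  fixes P :: "real \<Rightarrow> 'a::metric_space"
  assumes "a \<le> b" and cont: "continuous_on {a..b} \<phi>"
    and P: "\<And>s t. a \<le> s \<Longrightarrow> s \<le> t \<Longrightarrow> t \<le> b \<Longrightarrow> dist (P s) (P t) \<le> (t - s) * max (\<phi> s) (\<phi> t)"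
  shows "dist (P a) (P b) \<le> integral {a..b} \<phi>"
proof (rule field_le_epsilon)
  fix e :: real assume e: "0 < e"
  \<comment> \<open>The summand 1 keeps the denominator positive when \<open>a = b\<close>.\<close>
  define d where "d = e / (b - a + 1)"
  have d: "0 < d" using e assms(1) by (simp add: d_def)
  \<comment> \<open>The guards are there because the local condition of \<open>Bolzano\<close> also
    ranges over intervals that leave \<open>{a..b}\<close>.\<close>
  define Q where "Q u v \<longleftrightarrow> (a \<le> u \<longrightarrow> v \<le> b \<longrightarrow>
    dist (P u) (P v) \<le> integral {u..v} \<phi> + d * (v - u))" for u v
  have "Q a b"
  proof (rule Bolzano[OF assms(1)])
    fix u v w
    assume uv: "Q u v" and vw: "Q v w" and le: "u \<le> v" "v \<le> w"
    show "Q u w"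
      unfolding Q_def
    proof (intro impI)
      assume "a \<le> u" "w \<le> b"
      then have "\<phi> integrable_on {u..w}"
        by (intro integrable_continuous_real continuous_on_subset[OF cont]) auto
      from Henstock_Kurzweil_Integration.integral_combine[OF le this]
      show "dist (P u) (P w) \<le> integral {u..w} \<phi> + d * (w - u)"
        using uv[unfolded Q_def] vw[unfolded Q_def] le \<open>a \<le> u\<close> \<open>w \<le> b\<close> dist_triangle[of "P u" "P w" "P v"]
        by (simp add: algebra_simps)
    qed
  next
    fix c assume c: "a \<le> c" "c \<le> b"
    then obtain \<delta> where \<delta>: "0 < \<delta>"
      "\<And>x. x \<in> {a..b} \<Longrightarrow> dist x c < \<delta> \<Longrightarrow> dist (\<phi> x) (\<phi> c) < d / 2"
      using cont d unfolding continuous_on_iff by (metis atLeastAtMost_iff half_gt_zero)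
    have "dist (P u) (P v) \<le> integral {u..v} \<phi> + d * (v - u)"
      if uv: "u \<le> c" "c \<le> v" "v - u < \<delta>" "a \<le> u" "v \<le> b" for u v
    proof -
      have near: "\<bar>\<phi> x - \<phi> c\<bar> < d / 2" if "x \<in> {u..v}" for x
        using \<delta>(2)[of x] that uv by (auto simp: dist_real_def)
      have "dist (P u) (P v) \<le> (v - u) * max (\<phi> u) (\<phi> v)" using P uv by force
      also have "\<dots> \<le> (v - u) * (\<phi> c + d / 2)"
        using near[of u, THEN abs_less_iff[THEN iffD1]] near[of v, THEN abs_less_iff[THEN iffD1]] uv
        by (intro mult_left_mono) auto
      also have "\<dots> = integral {u..v} (\<lambda>_. \<phi> c - d / 2) + d * (v - u)"
        using uv by (simp add: algebra_simps)
      also have "integral {u..v} (\<lambda>_. \<phi> c - d / 2) \<le> integral {u..v} \<phi>"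
      proof (intro integral_le integrable_continuous_real continuous_on_subset[OF cont])
        show "\<phi> c - d / 2 \<le> \<phi> x" if "x \<in> {u..v}" for x using near[OF that] by linarith
      qed (use uv in auto)
      finally show ?thesis by simp
    qed
    then show "\<exists>\<delta>>0. \<forall>u v. u \<le> c \<and> c \<le> v \<and> v - u < \<delta> \<longrightarrow> Q u v"
      using \<delta>(1) unfolding Q_def by blast
  qed
  moreover have "d * (b - a) \<le> e"
    using e assms(1) by (simp add: d_def field_simps)
  ultimately show "dist (P a) (P b) \<le> integral {a..b} \<phi> + e" by (simp add: Q_def)
qed

text \<open>Up to the choice of pole, this is the stereographic projection: inversion in the unit sphere
  maps the hyperplane at height 1 to a sphere of diameter 1 through the origin.\<close>

definition hyperplane_inversion :: "'a::euclidean_space \<Rightarrow> 'a \<times> real" where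
  "hyperplane_inversion x = (1 / (1 + (norm x)\<^sup>2)) *\<^sub>R (x, 1)"

text \<open>Expand the squared distance into its two components; substituting \<open>A - 1\<close>
  and \<open>B - 1\<close> for the squared norms recombines them. As a distance, the chordal metric
  becomes accessible to \<open>dist_le_integral\<close>.\<close>

lemma chordal_metric_eq_dist:
  "chordal_metric x y = dist (hyperplane_inversion x) (hyperplane_inversion y)"
proof -
  define A where "A = 1 + (norm x)\<^sup>2"
  define B where "B = 1 + (norm y)\<^sup>2"
  have pos: "0 < A" "0 < B" by (simp_all add: A_def B_def add_pos_nonneg)
  have xx: "x \<bullet> x = A - 1" and yy: "y \<bullet> y = B - 1"
    by (simp_all add: A_def B_def power2_norm_eq_inner)
  have 1: "(norm ((1/A) *\<^sub>R x - (1/B) *\<^sub>R y))\<^sup>2 = (x \<bullet> x) / A\<^sup>2 + (y \<bullet> y) / B\<^sup>2 - 2 * (x \<bullet> y) / (A * B)"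
    unfolding power2_norm_eq_inner
    by (simp add: inner_diff_left inner_diff_right inner_commute power2_eq_square field_simps)
  have 2: "(norm (x - y))\<^sup>2 = x \<bullet> x + y \<bullet> y - 2 * (x \<bullet> y)"
    unfolding power2_norm_eq_inner
    by (simp add: inner_diff_left inner_diff_right inner_commute)
  have "(norm ((1/A) *\<^sub>R x - (1/B) *\<^sub>R y))\<^sup>2 + (1/A - 1/B)\<^sup>2 = (norm (x - y))\<^sup>2 / (A * B)"
    using pos unfolding 1 2 xx yy by (simp add: field_simps power2_eq_square)
  then have "dist (hyperplane_inversion x) (hyperplane_inversion y) = sqrt ((norm (x - y))\<^sup>2 / (A * B))"
    by (simp add: hyperplane_inversion_def dist_norm norm_Pair A_def[symmetric] B_def[symmetric])
  also have "\<dots> = norm (x - y) / sqrt (A * B)"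
    by (simp add: real_sqrt_divide)
  finally show ?thesis by (simp add: chordal_metric_def A_def B_def)
qed

text \<open>Writing \<open>m = \<surd>(1 + r\<^sup>2) - r\<close> for \<open>r = \<parallel>z\<parallel>\<close>, the constant is \<open>1 / (2 * m)\<close>, and the
  inequality amounts to \<open>(\<parallel>w\<parallel> - m)\<^sup>2 \<ge> 0\<close>.\<close>

lemma norm_diff_le_chordal_density:
  fixes w z :: "'a::real_normed_vector"
  shows "norm (w - z) \<le> (norm z + sqrt (1 + (norm z)\<^sup>2)) / 2 * (1 + (norm w)\<^sup>2)"
proof -
  define r s a where "r = norm z" and "s = sqrt (1 + r\<^sup>2)" and "a = norm w"
  have s2: "s\<^sup>2 = 1 + r\<^sup>2" by (simp add: s_def)
  have r0: "0 \<le> r" by (simp add: r_def)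
  have s1: "0 < s" by (simp add: s_def add_pos_nonneg)
  \<comment> \<open>Here \<open>s - r\<close> is the number \<open>m\<close> above, and
    \<open>(s + r) * (s - r) = 1\<close>.\<close>
  have "0 \<le> (s + r) * (a - (s - r))\<^sup>2" using r0 s1 by simp
  also have "\<dots> = (s + r) * (1 + a\<^sup>2) - 2 * (a + r)"
    using s2 by algebra
  finally have "a + r \<le> (r + s) / 2 * (1 + a\<^sup>2)" by (simp add: field_simps)
  moreover have "norm (w - z) \<le> a + r" unfolding a_def r_def by (rule norm_triangle_ineq4)
  ultimately show ?thesis by (simp add: r_def s_def a_def)
qed

text \<open>The curve, parametrized by arc length, is mapped by \<open>hyperplane_inversion\<close>,
  and \<open>dist_le_integral\<close> is applied with \<open>C\<close> times the quasihyperbolic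
  density as \<open>\<phi>\<close>.\<close>

lemma chordal_metric_le_arc_length_integral:
  fixes z :: "'a::euclidean_space"
  assumes \<gamma>: "rectifiable_path \<gamma>" and z: "z \<notin> path_image \<gamma>"
  defines "C \<equiv> (norm z + sqrt (1 + (norm z)\<^sup>2)) / 2"
  shows "chordal_metric (pathstart \<gamma>) (pathfinish \<gamma>)
    \<le> C * arc_length_integral \<gamma> (\<lambda>w. 1 / dist w z)"
proof -
  define L g where "L = curve_length \<gamma> 0 1" and "g = arc_length_param \<gamma>"
  define \<phi> where "\<phi> s = C * (1 / dist (g s) z)" for s
  have L: "0 \<le> L" using curve_length_mono[OF \<gamma>, of 0 1] by (simp add: L_def)
  have gz: "g s \<noteq> z" if "s \<in> {0..L}" for s
    using arc_length_param_in_path_image[OF \<gamma>] that z by (auto simp: g_def L_def)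
  have C: "0 \<le> C" by (simp add: C_def)
  have "continuous_on (path_image \<gamma>) (\<lambda>w. 1 / dist w z)"
    using z by (intro continuous_intros) auto
  then have cont: "continuous_on {0..L} \<phi>"
    unfolding \<phi>_def g_def L_def
    by (intro continuous_on_mult_left continuous_on_compose_arc_length_param \<gamma>)
  have density: "1 / (1 + (norm (g s))\<^sup>2) \<le> \<phi> s" if "s \<in> {0..L}" for s
    using norm_diff_le_chordal_density[of "g s" z] gz[OF that]
    by (simp add: \<phi>_def dist_norm add_pos_nonneg divide_simps flip: C_def)
  have "dist (hyperplane_inversion (g s)) (hyperplane_inversion (g t)) \<le> (t - s) * max (\<phi> s) (\<phi> t)"
    if st: "0 \<le> s" "s \<le> t" "t \<le> L" for s t
  proof -
    \<comment> \<open>The geometric mean of \<open>A\<close> and \<open>B\<close> is at least their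
      minimum \<open>m\<close>, and \<open>1 / m\<close> is the larger of the chordal densities at
      the two ends; hence the \<open>max\<close> in \<open>dist_le_integral\<close>.\<close>
    define A B m where "A = 1 + (norm (g s))\<^sup>2" and "B = 1 + (norm (g t))\<^sup>2" and "m = min A B"
    have AB: "1 \<le> A" "1 \<le> B" by (simp_all add: A_def B_def)
    have m: "1 \<le> m" using AB by (simp add: m_def)
    have "m * m \<le> A * B" using AB m by (intro mult_mono) (auto simp: m_def)
    then have mAB: "m \<le> sqrt (A * B)" by (intro real_le_rsqrt) (simp add: power2_eq_square)
    have "chordal_metric (g s) (g t) \<le> (t - s) / m"
      unfolding chordal_metric_def A_def[symmetric] B_def[symmetric]
      using dist_arc_length_param_le[OF \<gamma>, of s t] st m mAB
      by (intro frac_le) (auto simp: g_def L_def dist_norm)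
    also have "\<dots> = (t - s) * (1 / m)" by simp
    also have "1 / m \<le> max (\<phi> s) (\<phi> t)"
      using density[of s] density[of t] st
      by (cases "A \<le> B") (auto simp: m_def A_def B_def)
    finally show ?thesis using st by (simp add: chordal_metric_eq_dist mult_left_mono)
  qed
  then have "dist (hyperplane_inversion (g 0)) (hyperplane_inversion (g L)) \<le> integral {0..L} \<phi>"
    by (intro dist_le_integral[OF L cont]) auto
  also have "integral {0..L} \<phi> = C * arc_length_integral \<gamma> (\<lambda>w. 1 / dist w z)"
    unfolding \<phi>_def arc_length_integral_def L_def g_def by (rule integral_mult_right)
  finally show ?thesis
    using arc_length_param_0[OF \<gamma>] arc_length_param_length[OF \<gamma>]
    by (simp add: chordal_metric_eq_dist g_def L_def)
qed

section \<open>The punctured space\<close>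

lemma quasihyperbolic_metric_punctured:
  fixes z :: "'a::euclidean_space"
  shows "quasihyperbolic_metric (UNIV - {z}) x y =
    Inf {arc_length_integral \<gamma> (\<lambda>w. 1 / dist w z) | \<gamma>.
      rectifiable_path \<gamma> \<and> z \<notin> path_image \<gamma> \<and> pathstart \<gamma> = x \<and> pathfinish \<gamma> = y}"
proof -
  have "frontier (UNIV - {z}) = {z}"
    using frontier_complement[of "{z}"] by (simp add: frontier_def Compl_eq_Diff_UNIV)
  moreover have "infdist w {z} = dist w z" for w by simp
  moreover have "path_image \<gamma> \<subseteq> UNIV - {z} \<longleftrightarrow> z \<notin> path_image \<gamma>" for \<gamma> by blast
  ultimately show ?thesis unfolding quasihyperbolic_metric_def by simp
qed

text \<open>The curve estimate passes to the infimum. Dimension at least 2 makes the punctured space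
  connected, so the infimum is over a nonempty set.\<close>

lemma chordal_le_quasihyperbolic_punctured:
  fixes z :: "'a::euclidean_space"
  assumes "2 \<le> DIM('a)" "x \<noteq> z" "y \<noteq> z"
  shows "chordal_metric x y \<le>
    (norm z + sqrt (1 + (norm z)\<^sup>2)) / 2 * quasihyperbolic_metric (UNIV - {z}) x y"
proof -
  define C where "C = (norm z + sqrt (1 + (norm z)\<^sup>2)) / 2"
  have "0 < sqrt (1 + (norm z)\<^sup>2)" by (simp add: add_pos_nonneg)
  then have C: "0 < C" by (simp add: C_def add_nonneg_pos)
  obtain \<gamma> where "rectifiable_path \<gamma>" "path_image \<gamma> \<subseteq> - {z}" "pathstart \<gamma> = x" "pathfinish \<gamma> = y"
    using connected_open_rectifiable[of "- {z}" x y] connected_punctured_universe[of z] assms by auto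
  then have "chordal_metric x y / C \<le> quasihyperbolic_metric (UNIV - {z}) x y"
    unfolding quasihyperbolic_metric_punctured
    using chordal_metric_le_arc_length_integral[of _ z] C
    by (intro cInf_greatest) (fastforce simp: C_def[symmetric] field_simps)+
  then show ?thesis using C by (simp add: C_def[symmetric] field_simps)
qed

text \<open>The segment from \<open>x\<close> to \<open>y\<close> is a competitor, and by the
  triangle inequality it stays at distance at least \<open>dist x z - dist x y\<close> from
  \<open>z\<close>.\<close>

lemma quasihyperbolic_punctured_le:
  fixes z :: "'a::euclidean_space"
  assumes xy: "dist x y < dist x z"
  shows "quasihyperbolic_metric (UNIV - {z}) x y \<le> dist x y / (dist x z - dist x y)"
proof -
  define C where "C = (norm z + sqrt (1 + (norm z)\<^sup>2)) / 2"
  have "0 < sqrt (1 + (norm z)\<^sup>2)" by (simp add: add_pos_nonneg)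
  then have C: "0 < C" by (simp add: C_def add_nonneg_pos)
  let ?\<gamma> = "linepath x y"
  have "dist (?\<gamma> u) (?\<gamma> v) \<le> dist x y * (v - u)" if "u \<le> v" for u v
  proof -
    have "?\<gamma> u - ?\<gamma> v = (v - u) *\<^sub>R (x - y)" by (simp add: linepath_def algebra_simps)
    then show ?thesis using that by (simp add: dist_norm)
  qed
  then have \<gamma>: "rectifiable_path ?\<gamma>" and len: "curve_length ?\<gamma> 0 1 \<le> dist x y"
    using lipschitz_imp_rectifiable_path[of ?\<gamma> "dist x y"] by blast+
  have far: "dist x z - dist x y \<le> dist w z" if "w \<in> path_image ?\<gamma>" for w
    using that dist_in_closed_segment[of w x y] dist_triangle[of x z w]
    by (auto simp: dist_commute)
  have z: "z \<notin> path_image ?\<gamma>" using far[of z] xy by auto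
  have "quasihyperbolic_metric (UNIV - {z}) x y \<le> arc_length_integral ?\<gamma> (\<lambda>w. 1 / dist w z)"
    unfolding quasihyperbolic_metric_punctured
  proof (rule cInf_lower)
    \<comment> \<open>The comparison with the chordal metric supplies the lower bound that a real
      infimum requires.\<close>
    show "bdd_below {arc_length_integral \<gamma> (\<lambda>w. 1 / dist w z) | \<gamma>.
      rectifiable_path \<gamma> \<and> z \<notin> path_image \<gamma> \<and> pathstart \<gamma> = x \<and> pathfinish \<gamma> = y}"
      using chordal_metric_le_arc_length_integral[of _ z] C
      by (intro bdd_belowI[of _ "chordal_metric x y / C"]) (auto simp: C_def[symmetric] field_simps)
  qed (use \<gamma> z in \<open>auto intro!: exI[of _ ?\<gamma>]\<close>)
  also have "\<dots> \<le> 1 / (dist x z - dist x y) * curve_length ?\<gamma> 0 1"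
  proof (rule arc_length_integral_le[OF \<gamma>])
    show "continuous_on (path_image ?\<gamma>) (\<lambda>w. 1 / dist w z)"
      using z by (intro continuous_intros) auto
    show "1 / dist w z \<le> 1 / (dist x z - dist x y)" if "w \<in> path_image ?\<gamma>" for w
      using far[OF that] xy by (intro frac_le) auto
  qed
  also have "\<dots> \<le> 1 / (dist x z - dist x y) * dist x y"
    using len xy by (intro mult_left_mono) auto
  finally show ?thesis by simp
qed

text \<open>With the supremum taken in \<open>ereal\<close>, the equation also asserts that the
  quotients are bounded.\<close>

theorem theorem3p3:
  fixes z :: "real ^ 'n" and G :: "(real ^ 'n) set"
  assumes "CARD('n) \<ge> 2"
    and "G = UNIV - {z}"
  shows "(SUP (x, y) \<in> {(x, y). x \<in> G \<and> y \<in> G \<and> x \<noteq> y}.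
            ereal (chordal_metric x y / quasihyperbolic_metric G x y))
         = ereal ((norm z + sqrt (1 + (norm z)\<^sup>2)) / 2)"
proof (rule antisym)
  define r s where "r = norm z" and "s = sqrt (1 + r\<^sup>2)"
  let ?C = "(norm z + sqrt (1 + (norm z)\<^sup>2)) / 2"
  let ?S = "SUP (x, y) \<in> {(x, y). x \<in> G \<and> y \<in> G \<and> x \<noteq> y}.
            ereal (chordal_metric x y / quasihyperbolic_metric G x y)"
  have s2: "s\<^sup>2 = 1 + r\<^sup>2" by (simp add: s_def)
  have r0: "0 \<le> r" by (simp add: r_def)
  have s1: "0 < s" by (simp add: s_def add_pos_nonneg)
  have rs: "r < s" using s2 r0 s1 by (intro power2_less_imp_less[of r s]) auto
  have C: "?C = (r + s) / 2" by (simp add: r_def s_def)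
  have upper: "chordal_metric x y \<le> ?C * quasihyperbolic_metric G x y" if "x \<in> G" "y \<in> G" for x y
    using chordal_le_quasihyperbolic_punctured[of x z y] that assms by simp
  have pos: "0 < chordal_metric x y" if "x \<noteq> y" for x y :: "real ^ 'n"
    using that by (simp add: chordal_metric_def add_pos_nonneg)
  \<comment> \<open>The upper bound forces positivity, so no quotient is a default value of division
    by zero.\<close>
  have kpos: "0 < quasihyperbolic_metric G x y" if "x \<in> G" "y \<in> G" "x \<noteq> y" for x y
  proof -
    have "0 < ?C * quasihyperbolic_metric G x y" using upper[of x y] pos[of x y] that by linarith
    then show ?thesis unfolding C using r0 s1 by (simp add: zero_less_mult_iff)
  qed
  show "?S \<le> ereal ?C"
    using upper kpos by (intro SUP_least) (auto simp: pos_divide_le_eq)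
  obtain e :: "real ^ 'n" where e: "norm e = 1" "z = r *\<^sub>R e"
  proof (cases "z = 0")
    case True
    obtain e :: "real ^ 'n" where "norm e = 1" using vector_choose_size[of 1] by auto
    with True show ?thesis using that by (simp add: r_def)
  next
    case False
    then show ?thesis using that[of "(1 / r) *\<^sub>R z"] by (simp add: r_def)
  qed
  \<comment> \<open>This is the extremal point: its coefficient is negative since
    \<open>r < s\<close>. For \<open>0 < h < s\<close> the point \<open>y h\<close> lies between
    \<open>x\<close> and \<open>z\<close>.\<close>
  define x where "x = (r - s) *\<^sub>R e"
  define y where "y h = (r - s + h) *\<^sub>R e" for h
  have xy: "dist x (y h) = \<bar>h\<bar>" for h
    using e(1) by (simp add: x_def y_def dist_norm flip: scaleR_diff_left)
  have xz: "dist x z = s"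
    using e s1 by (simp add: x_def dist_norm flip: scaleR_diff_left)
  \<comment> \<open>For small positive \<open>h\<close> this bounds the quotient of the metrics from
    below, by the segment estimate. The absolute value matches \<open>dist x (y h)\<close>, and
    \<open>f\<close> is continuous at 0.\<close>
  define f where "f h = (s - \<bar>h\<bar>) / sqrt ((1 + (norm x)\<^sup>2) * (1 + (norm (y h))\<^sup>2))" for h
  have "ereal (f h) \<le> ?S" if h: "0 < h" "h < s" for h
  proof -
    have ne: "x \<in> G" "y h \<in> G" "x \<noteq> y h"
      using xz xy[of h] h s1 assms by (auto simp: dist_commute)
    define k where "k = quasihyperbolic_metric G x (y h)"
    have k: "0 < k" using kpos[OF ne] by (simp add: k_def)
    have "k \<le> h / (s - h)"
      using quasihyperbolic_punctured_le[of x "y h" z] xy xz h assms by (simp add: k_def)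
    then have "s - h \<le> h / k" using k h by (simp add: field_simps)
    then have "f h \<le> (h / k) / sqrt ((1 + (norm x)\<^sup>2) * (1 + (norm (y h))\<^sup>2))"
      unfolding f_def using h by (intro divide_right_mono) auto
    also have "\<dots> = chordal_metric x (y h) / k"
      using xy[of h] h by (simp add: chordal_metric_def dist_norm)
    finally have "ereal (f h) \<le> ereal (chordal_metric x (y h) / quasihyperbolic_metric G x (y h))"
      by (simp add: k_def)
    also have "\<dots> \<le> ?S" using ne by (intro SUP_upper2[of "(x, y h)"]) auto
    finally show ?thesis .
  qed
  then have "\<forall>\<^sub>F h in at_right 0. ereal (f h) \<le> ?S"
    using s1 by (auto simp: eventually_at_right_field)
  moreover have "((\<lambda>h. ereal (f h)) \<longlongrightarrow> ereal (f 0)) (at_right 0)"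
  proof -
    have "1 + a\<^sup>2 \<noteq> 0" for a :: real by (simp add: add_nonneg_eq_0_iff)
    then have "isCont f 0"
      unfolding f_def y_def by (intro continuous_intros) simp
    then show ?thesis
      by (simp add: isCont_def filterlim_at_split)
  qed
  ultimately have "ereal (f 0) \<le> ?S"
    by (intro tendsto_upperbound[of _ _ "at_right 0"]) auto
  moreover have "f 0 = ?C"
  proof -
    have "norm x = s - r" using e(1) rs by (simp add: x_def)
    moreover have "y 0 = x" by (simp add: x_def y_def)
    \<comment> \<open>Both factors under the root in \<open>f 0\<close> equal this number, so the
      root is the number itself; \<open>(s - r) * (s + r) = 1\<close> then gives the
      constant.\<close>
    moreover have "1 + (s - r)\<^sup>2 = 2 * s * (s - r)" using s2 by algebra
    moreover have "0 < 2 * s * (s - r)" using s1 rs by simp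
    ultimately have "f 0 = s / (2 * s * (s - r))" by (simp only: f_def real_sqrt_abs2) simp
    also have "\<dots> = 1 / (2 * (s - r))" using s1 by simp
    also have "\<dots> = (r + s) / 2"
      using rs s2 by (simp add: field_simps power2_eq_square)
    finally show ?thesis by (simp add: C)
  qed
  ultimately show "ereal ?C \<le> ?S" by simp
qed

end
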